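(* Let $\kappa$ be a regular infinite cardinal and $\mu$ a singular cardinal with $\mathrm{cf}(\mu)=\kappa$. The spaces $({}^{\mu}2,\mu)$ and $({}^{\mu}\mu,\mu)$ are homeomorphic if and only if $\mu$ is not a strong limit cardinal (i.e., iff there is $\lambda<\mu$ with $2^\lambda\ge\mu$).
   Context: For ordinals $\delta,\rho$, ${}^{\delta}\rho$ is the set of functions $\delta\to\rho$; for a partial function $s\colon\delta\rightharpoonup\rho$, $[s]=\{f\in{}^{\delta}\rho: s\subseteq f\}$. The ${<}\mu$-box topology on ${}^{\delta}\rho$ has base $\{[s]: |\mathrm{dom}(s)|<\mu\}$; $(X,\mu)$ denotes $X$ with this topology. *)

theory Defs
  imports "HOL-Analysis.Analysis"
begin

definition cf_equals :: "'a set \<Rightarrow> 'k set \<Rightarrow> bool" where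
  "cf_equals A K \<longleftrightarrow>
     (\<exists>C. C \<subseteq> Field (card_of A) \<and> cofinal C (card_of A) \<and> (card_of C, card_of K) \<in> ordIso) \<and>
     (\<forall>C. C \<subseteq> Field (card_of A) \<and> cofinal C (card_of A) \<longrightarrow> (card_of K, card_of C) \<in> ordLeq)"

definition box_cyl :: "('a \<Rightarrow> 'b option) \<Rightarrow> ('a \<Rightarrow> 'b) set" where
  "box_cyl s = {f. s \<subseteq>\<^sub>m (Some \<circ> f)}"

definition box_topology :: "'c set \<Rightarrow> ('a \<Rightarrow> 'b) topology" where
  "box_topology M = topology_generated_by {box_cyl s | s. (card_of (dom s), card_of M) \<in> ordLess}"

end

(*
If 2^L >= mu for some L < mu, then 2^L = mu^L, and grouping the mu coordinates into blocks of size L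
identifies both spaces with the <mu-box power of mu many copies of one discrete space of that size.

If mu is a strong limit, then pairwise disjoint cylinders of 2^mu with supports of bounded size
L < mu number fewer than mu. Suppose that 2^mu were homeomorphic to mu^mu and let C be cofinal in mu
with |C| < mu. For each c in C the mu many disjoint open sets {f. f c = alpha} correspond to open sets
of 2^mu, one of which, for alpha = alpha(c), contains no cylinder of support size at most |c|.
But {f. f c = alpha(c) for all c in C} is open and nonempty, so it corresponds to a set containing
a cylinder, whose support size is at most |c| for some c in C: a contradiction.
*)
theory Submission
  imports Defs
begin

unbundle cardinal_syntax
no_notation Set_Algebras.elt_set_eq (infix "=o" 50)

subsection \<open>Cardinal arithmetic\<close>

lemma finite_ordLess_infinite_card_of: "finite A \<Longrightarrow> infinite B \<Longrightarrow> |A| <o |B|"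
  using card_of_ordLeq_finite[of B A] not_ordLeq_iff_ordLess[OF card_of_Well_order card_of_Well_order] by blast

lemma Times_ordLess_bounded:
  assumes "|D| <o |C|" "infinite D" "|A| \<le>o |D|" "|B| \<le>o |D|"
  shows "|A \<times> B| <o |C|"
proof -
  have "|A \<times> B| \<le>o |D \<times> D|"
    using card_of_Times_mono1[OF assms(3)] card_of_Times_mono2[OF assms(4)] ordLeq_transitive by blast
  also have "|D \<times> D| =o |D|" by (rule card_of_Times_same_infinite[OF assms(2)])
  finally show ?thesis using assms(1) ordLeq_ordLess_trans by blast
qed

lemma Times_ordLess_infinite:
  assumes "infinite C" "|A| <o |C|" "|B| <o |C|"
  shows "|A \<times> B| <o |C|"
proof (cases "finite A \<and> finite B")
  case True
  then show ?thesis using assms(1) by (simp add: finite_ordLess_infinite_card_of)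
next
  case False
  then consider "|A| \<le>o |B|" "infinite B" | "|B| \<le>o |A|" "infinite A"
    by (meson card_of_ordLeq_infinite ordLeq_total card_of_Well_order)
  then show ?thesis
  proof cases
    case 1
    then show ?thesis
      by (intro Times_ordLess_bounded[OF assms(3) _ _ ordLeq_refl[OF card_of_Card_order]])
  next
    case 2
    then show ?thesis
      by (intro Times_ordLess_bounded[OF assms(2) _ ordLeq_refl[OF card_of_Card_order]])
  qed
qed

lemma card_of_Pow_cong: "|A| =o |B| \<Longrightarrow> |Pow A| =o |Pow B|"
  unfolding card_of_ordIso[symmetric] by (elim exE) (rule exI, rule bij_betw_Pow)

lemma card_of_Pow_mono: "|A| \<le>o |B| \<Longrightarrow> |Pow A| \<le>o |Pow B|"
proof -
  assume "|A| \<le>o |B|"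
  then obtain f where f: "inj_on f A" "f ` A \<subseteq> B" using card_of_ordLeq by metis
  show ?thesis unfolding card_of_ordLeq[symmetric]
    using f inj_on_image_Pow[of f A] by (intro exI[of _ "(`) f"]) auto
qed

text \<open>This is uncurrying: a family of sets indexed by \<open>A\<close> is determined by its
  graph in \<open>A \<times> B\<close>. Members of \<open>Func\<close> all take the value
  \<open>undefined\<close> off \<open>A\<close>, so the graph loses nothing.\<close>

lemma card_of_Func_Pow: "|Func A (Pow B)| \<le>o |Pow (A \<times> B)|"
proof -
  let ?f = "\<lambda>w. {(a, b). a \<in> A \<and> b \<in> w a}"
  have "inj_on ?f (Func A (Pow B))"
  proof (rule inj_onI)
    fix v w assume vw: "v \<in> Func A (Pow B)" "w \<in> Func A (Pow B)" and eq: "?f v = ?f w"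
    show "v = w"
    proof
      fix a show "v a = w a"
        using vw eq by (cases "a \<in> A") (auto simp: Func_def set_eq_iff)
    qed
  qed
  moreover have "?f ` Func A (Pow B) \<subseteq> Pow (A \<times> B)" by (auto simp: Func_def)
  ultimately show ?thesis using card_of_ordLeq by blast
qed

lemma card_of_Func_mono2: "|B| \<le>o |C| \<Longrightarrow> |Func A B| \<le>o |Func A C|"
proof -
  assume "|B| \<le>o |C|"
  then obtain h where h: "inj_on h B" "h ` B \<subseteq> C" using card_of_ordLeq by metis
  let ?f = "\<lambda>w a. if a \<in> A then h (w a) else undefined"
  have "inj_on ?f (Func A B)"
  proof (rule inj_onI)
    fix v w assume vw: "v \<in> Func A B" "w \<in> Func A B" and eq: "?f v = ?f w"
    show "v = w"
    proof
      fix a show "v a = w a"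
        using vw fun_cong[OF eq, of a] h(1) by (cases "a \<in> A") (auto simp: Func_def inj_on_def)
    qed
  qed
  moreover have "?f ` Func A B \<subseteq> Func A C" using h(2) by (auto simp: Func_def)
  ultimately show ?thesis using card_of_ordLeq by blast
qed

lemma not_ordLess_card_of: "\<not> |A| <o |B| \<longleftrightarrow> |B| \<le>o |A|"
  by (simp add: not_ordLess_iff_ordLeq card_of_Well_order)

lemma ordLess_card_of_subset:
  assumes "|A| <o |UNIV :: 'a set|"
  shows "\<exists>A' :: 'a set. |A| =o |A'|"
  using iffD1[OF internalize_card_of_ordLeq2 ordLess_imp_ordLeq[OF assms]] by blast

text \<open>The limit hypothesis speaks only of subsets of \<open>'a\<close>, whereas iterated power
  sets live in other types. A small \<open>B\<close> of any type is replaced by an equipotent subset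
  of \<open>'a\<close>, which allows iteration.\<close>

lemma strong_limit_Pow:
  assumes lim: "\<And>L :: 'a set. |L| <o |UNIV :: 'a set| \<Longrightarrow> |Pow L| <o |UNIV :: 'a set|"
    and B: "|B| <o |UNIV :: 'a set|"
  shows "|Pow B| <o |UNIV :: 'a set|"
proof -
  obtain B' :: "'a set" where B': "|B| =o |B'|" using ordLess_card_of_subset[OF B] by blast
  have "|B'| <o |UNIV :: 'a set|" by (rule ordIso_ordLess_trans[OF ordIso_symmetric[OF B'] B])
  from lim[OF this] show ?thesis by (rule ordIso_ordLess_trans[OF card_of_Pow_cong[OF B']])
qed

text \<open>Aleph_0 is regular, so a singular cardinal is uncountable. This leaves room below it for
  an infinite bound on supports.\<close>

lemma natLeq_ordLess_singular:
  assumes "infinite (UNIV :: 'a set)" "\<not> regularCard |UNIV :: 'a set|"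
  shows "|UNIV :: nat set| <o |UNIV :: 'a set|"
proof -
  have "|UNIV :: nat set| \<le>o |UNIV :: 'a set|"
    using assms(1) infinite_iff_card_of_nat by blast
  moreover have "\<not> |UNIV :: nat set| =o |UNIV :: 'a set|"
  proof
    assume "|UNIV :: nat set| =o |UNIV :: 'a set|"
    with card_of_nat have "natLeq =o |UNIV :: 'a set|"
      using ordIso_symmetric ordIso_transitive by blast
    then show False
      using assms(2) regularCard_ordIso[OF _ natLeq_Cinfinite regularCard_natLeq] by blast
  qed
  ultimately show ?thesis using ordLeq_iff_ordLess_or_ordIso by blast
qed

subsection \<open>Antichains of small partial functions\<close>

text \<open>
  Hewitt--Marczewski--Pondiczery: the functions \<open>x \<mapsto> ({l \<in> L. w l \<in> \<phi> x} \<in> g)\<close> are dense, and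
  there are few parameters \<open>(w, g)\<close>.
\<close>

lemma dense_family:
  fixes s :: "'a \<Rightarrow> bool option"
  assumes L: "infinite L" "|dom s| \<le>o |L|"
    and \<phi>: "inj_on \<phi> (dom s)" "\<phi> ` dom s \<subseteq> Pow N" and N: "N \<noteq> {}"
  shows "\<exists>w \<in> Func L N. \<exists>g \<in> Pow (Pow L). \<forall>x \<in> dom s. s x = Some ({l \<in> L. w l \<in> \<phi> x} \<in> g)"
proof (cases "s = Map.empty")
  case True
  then show ?thesis using N by (auto simp: Func_non_emp ex_in_conv)
next
  case False
  let ?D = "dom s"
  have "|?D \<times> ?D| \<le>o |L \<times> L|"
    using card_of_Times_mono1[OF L(2)] card_of_Times_mono2[OF L(2)] ordLeq_transitive by blast
  then have "|?D \<times> ?D| \<le>o |L|"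
    using card_of_Times_same_infinite[OF L(1)] ordLeq_ordIso_trans by blast
  moreover have "?D \<times> ?D \<noteq> {}" using False by auto
  \<comment> \<open>\<open>e\<close> lists all pairs of points of \<open>dom s\<close> along
    \<open>L\<close>, so that a single \<open>w\<close> on \<open>L\<close> can hold a separating
    point for every pair. Such a surjection needs a nonempty target unless \<open>L\<close> is
    empty, hence the separate case of the empty map.\<close>
  ultimately obtain e where e: "e ` L = ?D \<times> ?D" using card_of_ordLeq2 by metis
  obtain n0 where n0: "n0 \<in> N" using N by blast
  define sep where "sep p = (SOME n. n \<in> N \<and> (\<phi> (fst p) \<noteq> \<phi> (snd p) \<longrightarrow> (n \<in> \<phi> (fst p)) \<noteq> (n \<in> \<phi> (snd p))))" for p
  have sep: "sep p \<in> N \<and> (\<phi> (fst p) \<noteq> \<phi> (snd p) \<longrightarrow> (sep p \<in> \<phi> (fst p)) \<noteq> (sep p \<in> \<phi> (snd p)))"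
    if "p \<in> ?D \<times> ?D" for p
    unfolding sep_def
  proof (rule someI_ex, cases "\<phi> (fst p) = \<phi> (snd p)")
    case True
    then show "\<exists>n. n \<in> N \<and> (\<phi> (fst p) \<noteq> \<phi> (snd p) \<longrightarrow> (n \<in> \<phi> (fst p)) \<noteq> (n \<in> \<phi> (snd p)))"
      using n0 by auto
  next
    case False
    moreover have "\<phi> (fst p) \<subseteq> N" "\<phi> (snd p) \<subseteq> N"
      using \<phi>(2) that unfolding image_subset_iff by (metis PowD SigmaE fst_conv snd_conv)+
    ultimately show "\<exists>n. n \<in> N \<and> (\<phi> (fst p) \<noteq> \<phi> (snd p) \<longrightarrow> (n \<in> \<phi> (fst p)) \<noteq> (n \<in> \<phi> (snd p)))"
      by blast
  qed
  define w where "w l = (if l \<in> L then sep (e l) else undefined)" for l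
  \<comment> \<open>The trace of \<open>\<phi> x\<close> along \<open>w\<close>. As \<open>w\<close>
    separates all pairs, distinct points of \<open>dom s\<close> have distinct traces, so the traces
    of the points with value \<open>True\<close> can serve as \<open>g\<close>.\<close>
  define tr where "tr x = {l \<in> L. w l \<in> \<phi> x}" for x
  have "w \<in> Func L N"
  proof -
    have "sep (e l) \<in> N" if "l \<in> L" for l using sep[of "e l"] imageI[OF that, of e] e by simp
    then show ?thesis by (simp add: Func_def w_def)
  qed
  moreover have inj: "x = y" if x: "x \<in> ?D" and y: "y \<in> ?D" and eq: "tr x = tr y" for x y
  proof -
    obtain l where l: "l \<in> L" "e l = (x, y)" using e x y by (metis (no_types, lifting) SigmaI imageE)
    then have "w l = sep (x, y)" by (simp add: w_def)
    moreover have "w l \<in> \<phi> x \<longleftrightarrow> w l \<in> \<phi> y"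
      using equalityD1[OF eq] equalityD2[OF eq] l(1) unfolding tr_def by blast
    ultimately have "(sep (x, y) \<in> \<phi> x) = (sep (x, y) \<in> \<phi> y)" by simp
    then have "\<phi> x = \<phi> y" using sep[of "(x, y)"] x y by auto
    then show ?thesis using \<phi>(1) x y by (auto simp: inj_on_def)
  qed
  moreover have "\<forall>x \<in> ?D. s x = Some (tr x \<in> tr ` {x. s x = Some True})"
  proof
    fix x assume x: "x \<in> ?D"
    have "tr x \<in> tr ` {x. s x = Some True} \<longleftrightarrow> s x = Some True"
    proof
      assume "tr x \<in> tr ` {x. s x = Some True}"
      then obtain y where "s y = Some True" "tr x = tr y" by blast
      then show "s x = Some True" using inj[OF x] by auto
    qed simp
    then show "s x = Some (tr x \<in> tr ` {x. s x = Some True})" using x by auto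
  qed
  moreover have "tr ` {x. s x = Some True} \<in> Pow (Pow L)" by (auto simp: tr_def)
  ultimately show ?thesis unfolding tr_def by blast
qed

text \<open>Each member is extended by some function from the dense family. Two members assigned the
  same parameter \<open>(w, g)\<close> have a common extension and hence coincide, so the antichain
  is no larger than the set of parameters.\<close>

lemma antichain_bound:
  fixes S :: "('a \<Rightarrow> bool option) set" and L :: "'l set"
  assumes L: "infinite L" and small: "\<And>s. s \<in> S \<Longrightarrow> |dom s| \<le>o |L|"
    and anti: "\<And>s t f. s \<in> S \<Longrightarrow> t \<in> S \<Longrightarrow> s \<subseteq>\<^sub>m Some \<circ> f \<Longrightarrow> t \<subseteq>\<^sub>m Some \<circ> f \<Longrightarrow> s = t"
  shows "|S| <o |Pow (Pow (Pow L))|"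
proof (rule ccontr)
  let ?N = "Pow (Pow L)"
  assume "\<not> |S| <o |Pow ?N|"
  then have "|Pow ?N| \<le>o |S|" by (simp add: not_ordLess_card_of)
  \<comment> \<open>A subfamily of size exactly \<open>|Pow ?N|\<close> has a union of domains that
    injects into \<open>Pow ?N\<close>; one \<open>\<phi>\<close> then serves all its
    members.\<close>
  then obtain S' where S': "S' \<subseteq> S" "|Pow ?N| =o |S'|"
    using internalize_card_of_ordLeq2[of "Pow ?N" S] by blast
  have infP: "infinite (Pow L)" "infinite ?N" "infinite (Pow ?N)" using L by (simp_all)
  have LP: "|L| \<le>o |Pow L|" "|Pow L| \<le>o |?N|" "|?N| \<le>o |Pow ?N|"
    by (rule ordLess_imp_ordLeq[OF card_of_Pow])+
  have LPN: "|L| \<le>o |Pow ?N|" by (rule ordLeq_transitive[OF LP(1) ordLeq_transitive[OF LP(2,3)]])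
  define I where "I = (\<Union>s \<in> S'. dom s)"
  have "|I| \<le>o |Pow ?N|" unfolding I_def
  proof (rule card_of_UNION_ordLeq_infinite[OF infP(3)])
    show "|S'| \<le>o |Pow ?N|" using S'(2) ordIso_iff_ordLeq by blast
    show "\<forall>s \<in> S'. |dom s| \<le>o |Pow ?N|"
      using small S'(1) LPN ordLeq_transitive by blast
  qed
  then obtain \<phi> where \<phi>: "inj_on \<phi> I" "\<phi> ` I \<subseteq> Pow ?N" using card_of_ordLeq by metis
  have "\<forall>s \<in> S'. \<exists>p. p \<in> Func L ?N \<times> ?N \<and>
      (\<forall>x \<in> dom s. s x = Some ({l \<in> L. fst p l \<in> \<phi> x} \<in> snd p))" (is "\<forall>s \<in> S'. \<exists>p. ?Q s p")
  proof
    fix s assume s: "s \<in> S'"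
    have sub: "dom s \<subseteq> I" using s by (auto simp: I_def)
    have inj: "inj_on \<phi> (dom s)" by (rule inj_on_subset[OF \<phi>(1) sub])
    have im: "\<phi> ` dom s \<subseteq> Pow ?N" using \<phi>(2) sub by blast
    obtain w g where "w \<in> Func L ?N" "g \<in> Pow (Pow L)"
      "\<forall>x \<in> dom s. s x = Some ({l \<in> L. w l \<in> \<phi> x} \<in> g)"
      using dense_family[OF L small[OF subsetD[OF S'(1) s]] inj im Pow_not_empty] by (elim bexE)
    then show "\<exists>p. ?Q s p" by (intro exI[of _ "(w, g)"]) simp
  qed
  from bchoice[OF this] obtain p where p: "\<forall>s \<in> S'. ?Q s (p s)" by (elim exE)
  have "inj_on p S'"
  proof (rule inj_onI)
    fix s t assume st: "s \<in> S'" "t \<in> S'" "p s = p t"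
    let ?f = "\<lambda>x. {l \<in> L. fst (p s) l \<in> \<phi> x} \<in> snd (p s)"
    have "s \<subseteq>\<^sub>m Some \<circ> ?f" using p st(1) by (auto simp: map_le_def)
    moreover have "t \<subseteq>\<^sub>m Some \<circ> ?f" using p st(2,3) by (auto simp: map_le_def)
    ultimately show "s = t" by (rule anti[OF subsetD[OF S'(1) st(1)] subsetD[OF S'(1) st(2)]])
  qed
  then have "|S'| \<le>o |Func L ?N \<times> ?N|" using p card_of_ordLeq[of S' "Func L ?N \<times> ?N"] by blast
  \<comment> \<open>In exponents: (2^(2^L))^L = 2^(L * 2^L) = 2^(2^L).\<close>
  moreover have "|Func L ?N| \<le>o |?N|"
  proof -
    have "|L \<times> Pow L| \<le>o |Pow L \<times> Pow L|" using card_of_Times_mono1[OF LP(1)] .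
    then have "|L \<times> Pow L| \<le>o |Pow L|"
      using card_of_Times_same_infinite[OF infP(1)] ordLeq_ordIso_trans by blast
    from card_of_Pow_mono[OF this] show ?thesis by (rule ordLeq_transitive[OF card_of_Func_Pow])
  qed
  then have "|Func L ?N \<times> ?N| \<le>o |?N|"
    by (rule ordLeq_ordIso_trans[OF card_of_Times_mono1 card_of_Times_same_infinite[OF infP(2)]])
  ultimately have "|Pow ?N| \<le>o |?N|"
    by (rule ordIso_ordLeq_trans[OF S'(2) ordLeq_transitive])
  then show False using card_of_Pow not_ordLess_ordLeq by blast
qed

subsection \<open>The box topology\<close>

lemma box_cyl_Int:
  assumes "f \<in> box_cyl s" "f \<in> box_cyl t"
  shows "box_cyl s \<inter> box_cyl t = box_cyl (s ++ t)" "f \<in> box_cyl (s ++ t)"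
proof -
  \<comment> \<open>Both maps are restrictions of \<open>f\<close>, so they agree wherever both are
    defined.\<close>
  have comp: "s ++ t = t ++ s"
  proof
    fix a show "(s ++ t) a = (t ++ s) a"
      using assms by (cases "s a"; cases "t a") (force simp: box_cyl_def map_le_def map_add_def)+
  qed
  have 1: "g \<in> box_cyl (s ++ t)" if "g \<in> box_cyl s" "g \<in> box_cyl t" for g
    using that unfolding box_cyl_def mem_Collect_eq by (rule map_add_le_mapI)
  have 2: "g \<in> box_cyl t" "g \<in> box_cyl s" if "g \<in> box_cyl (s ++ t)" for g
    using that comp map_le_map_add map_le_trans unfolding box_cyl_def mem_Collect_eq by metis+
  show "box_cyl s \<inter> box_cyl t = box_cyl (s ++ t)" using 1 2 by blast
  show "f \<in> box_cyl (s ++ t)" using 1 assms by blast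
qed

lemma box_cyl_restrict: "box_cyl ((Some \<circ> g) |` C) = {f. \<forall>a \<in> C. f a = g a}"
proof -
  have "dom ((Some \<circ> g) |` C) = C" by auto
  then show ?thesis by (auto simp: box_cyl_def map_le_def)
qed

text \<open>The generating cylinders are already a base: two cylinders through a common point meet
  in a cylinder, whose support, a union of two sets smaller than the infinite \<open>M\<close>, is
  again small.\<close>

lemma openin_box_topology:
  fixes U :: "('a \<Rightarrow> 'b) set"
  assumes "infinite M"
  shows "openin (box_topology M) U \<longleftrightarrow>
    (\<forall>f \<in> U. \<exists>s. |dom s| <o |M| \<and> f \<in> box_cyl s \<and> box_cyl s \<subseteq> U)" (is "?lhs = ?rhs")
proof
  let ?B = "{box_cyl s | s :: 'a \<Rightarrow> 'b option. |dom s| <o |M|}"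
  have gen: "openin (box_topology M) V \<longleftrightarrow> generate_topology_on ?B V" for V
    by (simp add: box_topology_def openin_topology_generated_by_iff)
  {
    assume ?lhs
    then have "generate_topology_on ?B U" using gen by blast
    then show ?rhs
    proof induction
      case Empty
      then show ?case by simp
    next
      case (Int a b)
      show ?case
      proof
        fix f assume "f \<in> a \<inter> b"
        with Int.IH obtain s t where st: "|dom s| <o |M|" "f \<in> box_cyl s" "box_cyl s \<subseteq> a"
          "|dom t| <o |M|" "f \<in> box_cyl t" "box_cyl t \<subseteq> b" by blast
        have "|dom (s ++ t)| <o |M|"
          using card_of_Un_ordLess_infinite[OF assms st(4,1)] by simp
        then show "\<exists>s. |dom s| <o |M| \<and> f \<in> box_cyl s \<and> box_cyl s \<subseteq> a \<inter> b"
          using box_cyl_Int[OF st(2,5)] st(3,6) by blast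
      qed
    next
      case (UN K)
      then show ?case by (meson UnionE Union_upper subset_trans)
    next
      case (Basis s)
      then show ?case by blast
    qed
  }
  {
    assume R: ?rhs
    then have "U = \<Union>{V \<in> ?B. V \<subseteq> U}" by blast
    moreover have "generate_topology_on ?B (\<Union>{V \<in> ?B. V \<subseteq> U})"
      by (rule generate_topology_on.UN) (blast intro: generate_topology_on.Basis)
    ultimately show ?lhs using gen by simp
  }
qed

lemma topspace_box_topology:
  assumes "infinite M"
  shows "topspace (box_topology M :: ('a \<Rightarrow> 'b) topology) = UNIV"
proof -
  have "|dom (Map.empty :: 'a \<Rightarrow> 'b option)| <o |M|"
    using assms by (simp add: finite_ordLess_infinite_card_of)
  then have "openin (box_topology M) (UNIV :: ('a \<Rightarrow> 'b) set)"
    unfolding openin_box_topology[OF assms] box_cyl_def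
    by (auto intro!: exI[of _ "Map.empty"])
  then show ?thesis using openin_subset by blast
qed

lemma openin_box_cyl:
  assumes "infinite M" "|dom s| <o |M|"
  shows "openin (box_topology M) (box_cyl s)"
  unfolding openin_box_topology[OF assms(1)] using assms(2) by blast

lemma box_cyl_nonempty: "\<exists>f. f \<in> box_cyl s"
  by (intro exI[of _ "\<lambda>x. the (s x)"]) (auto simp: box_cyl_def map_le_def)

subsection \<open>Recoding blocks of coordinates\<close>

text \<open>The value \<open>undefined\<close> off \<open>L\<close> puts every block into
  \<open>Func L UNIV\<close>, the set on which the recoding bijection acts.\<close>

definition block :: "('a \<times> 'l \<Rightarrow> 'a) \<Rightarrow> 'l set \<Rightarrow> ('a \<Rightarrow> 'b) \<Rightarrow> 'a \<Rightarrow> 'l \<Rightarrow> 'b" where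
  "block e L x i = (\<lambda>l. if l \<in> L then x (e (i, l)) else undefined)"

text \<open>With \<open>e\<close> a bijection, \<open>e (i, l)\<close> is the \<open>l\<close>-th
  coordinate of block \<open>i\<close>, and \<open>\<Phi>\<close> rewrites each block independently
  of the others.\<close>

definition recode ::
    "('a \<times> 'l \<Rightarrow> 'a) \<Rightarrow> 'l set \<Rightarrow> (('l \<Rightarrow> 'b) \<Rightarrow> 'l \<Rightarrow> 'c) \<Rightarrow> ('a \<Rightarrow> 'b) \<Rightarrow> 'a \<Rightarrow> 'c" where
  "recode e L \<Phi> x a =
     (let (i, l) = inv_into (UNIV \<times> L) e a in \<Phi> (block e L x i) l)"

text \<open>An output coordinate depends on one input block only. Fewer than \<open>|M|\<close>
  output coordinates therefore depend on fewer than \<open>|M|\<close> blocks of size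
  \<open>|L|\<close>, which together are still fewer than \<open>|M|\<close> coordinates.\<close>

lemma continuous_map_recode:
  fixes \<Phi> :: "('l \<Rightarrow> 'b) \<Rightarrow> 'l \<Rightarrow> 'c" and e :: "'a \<times> 'l \<Rightarrow> 'a"
  assumes M: "infinite M" and L: "|L| <o |M|"
  shows "continuous_map (box_topology M) (box_topology M) (recode e L \<Phi>)"
  unfolding continuous_map_def topspace_box_topology[OF M]
proof (intro conjI allI impI)
  fix U :: "('a \<Rightarrow> 'c) set" assume U: "openin (box_topology M) U"
  show "openin (box_topology M) {x \<in> UNIV. recode e L \<Phi> x \<in> U}"
    unfolding openin_box_topology[OF M]
  proof
    fix x assume "x \<in> {x \<in> UNIV. recode e L \<Phi> x \<in> U}"
    then obtain t where t: "|dom t| <o |M|" "recode e L \<Phi> x \<in> box_cyl t" "box_cyl t \<subseteq> U"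
      using U openin_box_topology[OF M] by blast
    \<comment> \<open>The blocks that \<open>t\<close> touches; \<open>s\<close> freezes
      \<open>x\<close> on all of them.\<close>
    define J where "J = (fst \<circ> inv_into (UNIV \<times> L) e) ` dom t"
    define s where "s = (Some \<circ> x) |` (e ` (J \<times> L))"
    have "|J| <o |M|" unfolding J_def using t(1) card_of_image ordLeq_ordLess_trans by blast
    then have "|J \<times> L| <o |M|" using L Times_ordLess_infinite M by blast
    moreover have "dom s = e ` (J \<times> L)" by (auto simp: s_def)
    ultimately have "|dom s| <o |M|" using card_of_image ordLeq_ordLess_trans by metis
    moreover have "x \<in> box_cyl s" by (auto simp: box_cyl_def s_def map_le_def)
    moreover have "recode e L \<Phi> y \<in> U" if "y \<in> box_cyl s" for y
    proof -
      have y: "y (e (i, l)) = x (e (i, l))" if "i \<in> J" "l \<in> L" for i l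
        using \<open>y \<in> box_cyl s\<close> that unfolding s_def box_cyl_restrict by blast
      have "recode e L \<Phi> y a = recode e L \<Phi> x a" if "a \<in> dom t" for a
      proof -
        have "fst (inv_into (UNIV \<times> L) e a) \<in> J" using that by (auto simp: J_def)
        then have "block e L y (fst (inv_into (UNIV \<times> L) e a)) = block e L x (fst (inv_into (UNIV \<times> L) e a))"
          using y by (auto simp: block_def)
        then show ?thesis by (simp add: recode_def case_prod_beta)
      qed
      then have "recode e L \<Phi> y \<in> box_cyl t" using t(2) by (auto simp: box_cyl_def map_le_def)
      then show ?thesis using t(3) by blast
    qed
    ultimately show "\<exists>s. |dom s| <o |M| \<and> x \<in> box_cyl s \<and> box_cyl s \<subseteq> {x \<in> UNIV. recode e L \<Phi> x \<in> U}"
      by blast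
  qed
qed auto

lemma block_in_Func: "block e L x i \<in> Func L UNIV"
  by (auto simp: block_def Func_def)

lemma recode_inverse:
  assumes e: "bij_betw e (UNIV \<times> L) UNIV"
    and \<Phi>: "\<And>u. u \<in> Func L UNIV \<Longrightarrow> \<Phi> u \<in> Func L UNIV"
    and \<Psi>: "\<And>u. u \<in> Func L UNIV \<Longrightarrow> \<Psi> (\<Phi> u) = u"
  shows "recode e L \<Psi> (recode e L \<Phi> x) = x"
proof
  fix a
  have inv: "inv_into (UNIV \<times> L) e (e (i, l)) = (i, l)" if "l \<in> L" for i l
    using e that by (simp add: bij_betw_def)
  \<comment> \<open>Equality also holds off \<open>L\<close>, because \<open>\<Phi>\<close> maps
    into \<open>Func L UNIV\<close> and both sides are \<open>undefined\<close> there.\<close>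
  have "block e L (recode e L \<Phi> x) i = \<Phi> (block e L x i)" for i
  proof
    fix l show "block e L (recode e L \<Phi> x) i l = \<Phi> (block e L x i) l"
      using \<Phi>[OF block_in_Func[of e L x i]] inv
      by (cases "l \<in> L") (auto simp: block_def recode_def Func_def)
  qed
  then have "recode e L \<Psi> (recode e L \<Phi> x) (e (i, l)) = block e L x i l" if "l \<in> L" for i l
    using inv[OF that] \<Psi>[OF block_in_Func[of e L x i]] by (simp add: recode_def[of e L \<Psi>])
  moreover have "a \<in> e ` (UNIV \<times> L)" using e by (simp add: bij_betw_def)
  ultimately show "recode e L \<Psi> (recode e L \<Phi> x) a = x a" by (auto simp: block_def)
qed

lemma homeomorphic_if_not_strong_limit:
  fixes L :: "'l set"
  assumes M: "infinite (UNIV :: 'a set)" and L: "|L| <o |UNIV :: 'a set|" "|UNIV :: 'a set| \<le>o |Pow L|"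
  shows "(box_topology (UNIV :: 'a set) :: ('a \<Rightarrow> bool) topology)
    homeomorphic_space (box_topology (UNIV :: 'a set) :: ('a \<Rightarrow> 'a) topology)"
proof -
  have infL: "infinite L" using card_of_ordLeq_infinite[OF L(2) M] by simp
  have "|(UNIV :: 'a set) \<times> L| =o |UNIV :: 'a set|"
    using card_of_Times_infinite[OF M _ ordLess_imp_ordLeq[OF L(1)]] infL by auto
  then obtain e where e: "bij_betw e ((UNIV :: 'a set) \<times> L) (UNIV :: 'a set)" using card_of_ordIso by blast
  \<comment> \<open>The chain is mu^L <= (2^L)^L = 2^(L * L) = 2^L.\<close>
  have "|Func L (UNIV :: 'a set)| \<le>o |Func L (Pow L)|" by (rule card_of_Func_mono2[OF L(2)])
  also have "|Func L (Pow L)| \<le>o |Pow (L \<times> L)|" by (rule card_of_Func_Pow)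
  also have "|Pow (L \<times> L)| =o |Pow L|" by (rule card_of_Pow_cong[OF card_of_Times_same_infinite[OF infL]])
  also have "|Pow L| =o |Func L (UNIV :: bool set)|" by (rule card_of_Pow_Func)
  finally have le: "|Func L (UNIV :: 'a set)| \<le>o |Func L (UNIV :: bool set)|" .
  have "|UNIV :: bool set| \<le>o |UNIV :: 'a set|"
    using M by (meson finite finite_ordLess_infinite_card_of ordLess_imp_ordLeq)
  then have "|Func L (UNIV :: bool set)| \<le>o |Func L (UNIV :: 'a set)|" by (rule card_of_Func_mono2)
  with le have "|Func L (UNIV :: bool set)| =o |Func L (UNIV :: 'a set)|" by (simp add: ordIso_iff_ordLeq)
  then obtain \<Phi> where \<Phi>: "bij_betw \<Phi> (Func L (UNIV :: bool set)) (Func L (UNIV :: 'a set))"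
    using card_of_ordIso by blast
  let ?\<Psi> = "inv_into (Func L UNIV) \<Phi>"
  have "recode e L ?\<Psi> (recode e L \<Phi> x) = x" for x
    using e \<Phi> by (intro recode_inverse) (auto simp: bij_betw_def)
  moreover have "recode e L \<Phi> (recode e L ?\<Psi> y) = y" for y
    using e bij_betw_inv_into[OF \<Phi>] bij_betw_inv_into_right[OF \<Phi>]
    by (intro recode_inverse) (auto simp: bij_betw_def)
  ultimately have "homeomorphic_maps (box_topology (UNIV :: 'a set)) (box_topology (UNIV :: 'a set))
      (recode e L \<Phi>) (recode e L ?\<Psi>)"
    unfolding homeomorphic_maps_def 
    by (intro conjI continuous_map_recode[OF M L(1)]) simp_all
  then show ?thesis by (rule homeomorphic_maps_imp_homeomorphic_space)
qed

subsection \<open>Strong limits\<close>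

text \<open>A set smaller than mu is equipotent to a proper initial segment, and some point of
  \<open>C\<close> lies above the end of that segment. Thus the sizes of the segments below points
  of \<open>C\<close> bound every cardinal below mu.\<close>

lemma ordLess_underS_cofinal:
  assumes C: "cofinal C |UNIV :: 'a set|" and A: "|A| <o |UNIV :: 'a set|"
  shows "\<exists>c \<in> C. |A| \<le>o |underS |UNIV :: 'a set| c|"
proof -
  let ?r = "|UNIV :: 'a set|"
  obtain a where a: "|A| =o Restr ?r (underS ?r a)"
    using iffD1[OF ordLess_iff_ordIso_Restr[OF card_of_Well_order card_of_Well_order] A] by (elim bexE)
  obtain c where c: "c \<in> C" "a \<noteq> c" "(a, c) \<in> ?r"
    using C[unfolded cofinal_def Field_card_of, rule_format, OF UNIV_I[of a]] by (elim bexE conjE)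
  have "underS ?r a \<subseteq> underS ?r c"
    using c(3) well_order_on_Well_order[OF card_of_well_order_on[of "UNIV :: 'a set"]]
    by (intro underS_incr) (auto simp: order_on_defs)
  moreover have "Field (Restr ?r (underS ?r a)) \<subseteq> underS ?r a" by (auto simp: Field_def)
  ultimately have "|Field (Restr ?r (underS ?r a))| \<le>o |underS ?r c|" by (simp add: card_of_mono1)
  moreover have "|A| =o |Field (Restr ?r (underS ?r a))|"
    using card_of_cong[OF a] by (simp add: Field_card_of)
  ultimately have "|A| \<le>o |underS ?r c|" using ordIso_ordLeq_trans by blast
  then show ?thesis using c(1) by (rule rev_bexI[rotated])
qed

text \<open>
  Distinct \<open>P \<alpha>\<close> are disjoint, so cylinders inside them of bounded support size form an antichain.
\<close>

lemma wide_piece: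
  fixes P :: "'a \<Rightarrow> ('a \<Rightarrow> bool) set" and A :: "'a set"
  assumes nat: "|UNIV :: nat set| <o |UNIV :: 'a set|"
    and lim: "\<And>L :: 'a set. |L| <o |UNIV :: 'a set| \<Longrightarrow> |Pow L| <o |UNIV :: 'a set|"
    and A: "|A| <o |UNIV :: 'a set|" and disj: "\<And>\<alpha> \<beta>. \<alpha> \<noteq> \<beta> \<Longrightarrow> P \<alpha> \<inter> P \<beta> = {}"
  shows "\<exists>\<alpha>. \<forall>s. |dom s| \<le>o |A| \<longrightarrow> \<not> box_cyl s \<subseteq> P \<alpha>"
proof (rule ccontr)
  let ?U = "UNIV :: 'a set"
  have inf: "infinite ?U"
    by (rule card_of_ordLeq_infinite[OF ordLess_imp_ordLeq[OF nat] infinite_UNIV_nat])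
  obtain B :: "'a set" where B: "|UNIV :: nat set| =o |B|" using ordLess_card_of_subset[OF nat] by blast
  \<comment> \<open>\<open>A\<close> may be finite, but \<open>antichain_bound\<close> needs an
    infinite bound on supports. Adding a countable set keeps the bound below mu.\<close>
  define L where "L = A \<union> B"
  have "infinite B" by (rule card_of_ordLeq_infinite[OF ordIso_imp_ordLeq[OF B] infinite_UNIV_nat])
  then have infL: "infinite L" by (simp add: L_def)
  have "|B| <o |?U|" by (rule ordIso_ordLess_trans[OF ordIso_symmetric[OF B] nat])
  then have L: "|L| <o |?U|" unfolding L_def by (rule card_of_Un_ordLess_infinite[OF inf A])
  have bound: "|Pow (Pow (Pow L))| <o |?U|" 
    by (rule strong_limit_Pow[OF lim strong_limit_Pow[OF lim strong_limit_Pow[OF lim L]]])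
  assume "\<not> (\<exists>\<alpha>. \<forall>s. |dom s| \<le>o |A| \<longrightarrow> \<not> box_cyl s \<subseteq> P \<alpha>)"
  then have "\<forall>\<alpha>. \<exists>s. |dom s| \<le>o |A| \<and> box_cyl s \<subseteq> P \<alpha>" by blast
  from choice[OF this] obtain s
    where s: "\<And>\<alpha>. |dom (s \<alpha>)| \<le>o |A|" "\<And>\<alpha>. box_cyl (s \<alpha>) \<subseteq> P \<alpha>" by blast
  have uniq: "\<alpha> = \<beta>" if "f \<in> box_cyl (s \<alpha>)" "f \<in> box_cyl (s \<beta>)" for f \<alpha> \<beta>
    using that s(2) disj by blast
  have "inj s"
  proof (rule injI)
    fix \<alpha> \<beta> assume eq: "s \<alpha> = s \<beta>"
    obtain f where "f \<in> box_cyl (s \<alpha>)" using box_cyl_nonempty by blast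
    then show "\<alpha> = \<beta>" using uniq eq by metis
  qed
  then have le: "|?U| \<le>o |range s|" using card_of_ordLeq[of ?U "range s"] by blast
  have "|range s| <o |Pow (Pow (Pow L))|"
  proof (rule antichain_bound[OF infL])
    have "|A| \<le>o |L|" by (simp add: L_def card_of_mono1)
    then show "|dom t| \<le>o |L|" if "t \<in> range s" for t
      using that s(1) by (auto intro: ordLeq_transitive)
    show "t = u" if "t \<in> range s" "u \<in> range s" "t \<subseteq>\<^sub>m Some \<circ> f" "u \<subseteq>\<^sub>m Some \<circ> f" for t u f
      using that uniq unfolding box_cyl_def by blast
  qed
  then have "|range s| <o |?U|" by (rule ordLess_transitive[OF _ bound])
  then show False using le not_ordLess_ordLeq by blast
qed

lemma not_homeomorphic_if_strong_limit:
  assumes inf: "infinite (UNIV :: 'a set)" and sing: "\<not> regularCard |UNIV :: 'a set|"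
    and lim: "\<And>L :: 'a set. |L| <o |UNIV :: 'a set| \<Longrightarrow> |Pow L| <o |UNIV :: 'a set|"
  shows "\<not> (box_topology (UNIV :: 'a set) :: ('a \<Rightarrow> bool) topology)
    homeomorphic_space (box_topology (UNIV :: 'a set) :: ('a \<Rightarrow> 'a) topology)"
proof
  let ?U = "UNIV :: 'a set"
  let ?X = "box_topology ?U :: ('a \<Rightarrow> bool) topology" and ?Y = "box_topology ?U :: ('a \<Rightarrow> 'a) topology"
  assume "?X homeomorphic_space ?Y"
  then obtain h k where h: "continuous_map ?X ?Y h" and hk: "\<And>y. h (k y) = y"
    unfolding homeomorphic_space_def homeomorphic_maps_def topspace_box_topology[OF inf] by blast
  \<comment> \<open>Singularity supplies a cofinal set of size different from mu, hence
    smaller.\<close>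
  obtain C where C: "cofinal C |?U|" "\<not> |C| =o |?U|"
    using sing unfolding regularCard_def by blast
  then have smallC: "|C| <o |?U|"
    using card_of_mono1[OF subset_UNIV[of C]] by (simp add: ordLeq_iff_ordLess_or_ordIso)
  have underS: "|underS |?U| c| <o |?U|" for c
    using card_of_underS[OF card_of_Card_order, of c ?U] by (simp add: Field_card_of)
  \<comment> \<open>For fixed \<open>c\<close> the preimages of the sets
    \<open>{f. f c = \<alpha>}\<close> are pairwise disjoint, and the segment below \<open>c\<close>
    is smaller than mu, so \<open>wide_piece\<close> applies.\<close>
  have "\<exists>\<alpha>. \<forall>s. |dom s| \<le>o |underS |?U| c| \<longrightarrow> \<not> box_cyl s \<subseteq> {x. h x c = \<alpha>}" for c
    by (rule wide_piece[OF natLeq_ordLess_singular[OF inf sing] lim underS]) auto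
  then obtain \<alpha> where \<alpha>: "\<And>c s. |dom s| \<le>o |underS |?U| c| \<Longrightarrow> \<not> box_cyl s \<subseteq> {x. h x c = \<alpha> c}"
    by metis
  \<comment> \<open>\<open>t\<close> prescribes the bad value at every \<open>c\<close> in
    \<open>C\<close> at once; this gives an open cylinder only because \<open>C\<close> is
    small.\<close>
  define t where "t = (Some \<circ> \<alpha>) |` C"
  have "dom t = C" by (auto simp: t_def)
  then have "openin ?Y (box_cyl t)" using openin_box_cyl[OF inf] smallC by metis
  then have "openin ?X {x. h x \<in> box_cyl t}"
    using openin_continuous_map_preimage[OF h] by (simp add: topspace_box_topology[OF inf])
  moreover obtain y where "y \<in> box_cyl t" using box_cyl_nonempty by blast
  \<comment> \<open>The inverse \<open>k\<close> shows that the preimage is nonempty, so it contains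
    a cylinder.\<close>
  then have "k y \<in> {x. h x \<in> box_cyl t}" by (simp add: hk)
  ultimately obtain s where s: "|dom s| <o |?U|" "box_cyl s \<subseteq> {x. h x \<in> box_cyl t}"
    unfolding openin_box_topology[OF inf] by blast
  obtain c where c: "c \<in> C" "|dom s| \<le>o |underS |?U| c|"
    using ordLess_underS_cofinal[OF C(1) s(1)] by blast
  have "{x. h x \<in> box_cyl t} \<subseteq> {x. h x c = \<alpha> c}"
    using c(1) by (auto simp: t_def box_cyl_restrict)
  then show False using \<alpha>[OF c(2)] s(2) by blast
qed

theorem mainTheorem7:
  assumes kappa_inf: "infinite (UNIV :: 'k set)"
      and kappa_reg: "regularCard (card_of (UNIV :: 'k set))"
      and mu_inf: "infinite (UNIV :: 'a set)"
      and mu_sing: "\<not> regularCard (card_of (UNIV :: 'a set))"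
      and cf: "cf_equals (UNIV :: 'a set) (UNIV :: 'k set)"
  shows "((box_topology (UNIV :: 'a set) :: ('a \<Rightarrow> bool) topology)
           homeomorphic_space (box_topology (UNIV :: 'a set) :: ('a \<Rightarrow> 'a) topology))
         \<longleftrightarrow> (\<exists>L :: 'a set. (card_of L, card_of (UNIV :: 'a set)) \<in> ordLess \<and> (card_of (UNIV :: 'a set), card_of (Pow L)) \<in> ordLeq)"
    (is "?H \<longleftrightarrow> ?W")
proof
  assume ?H
  show ?W
  proof (rule ccontr)
    assume "\<not> ?W"
    then have "|Pow L| <o |UNIV :: 'a set|" if "|L| <o |UNIV :: 'a set|" for L :: "'a set"
      using that not_ordLess_card_of[of "Pow L" "UNIV :: 'a set"] by blast
    from not_homeomorphic_if_strong_limit[OF mu_inf mu_sing this] \<open>?H\<close> show False by (rule notE)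
  qed
next
  assume ?W
  then show ?H by (elim exE conjE) (rule homeomorphic_if_not_strong_limit[OF mu_inf])
qed

end
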